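(* For every $n\ge 1$ let $\theta_{0,n}\in\Theta_n$ and let $X^n\sim P_{\theta_{0,n},n}$ (planted bi-section model with edge probabilities $p_n,q_n$). Equip every $\Theta_n$ with its uniform prior. Write $p_n=a_n\,n^{-1}\log n$ and $q_n=b_n\,n^{-1}\log n$ (for $n\ge2$). Assume that $p_n=O(n^{-1/2})$ and $q_n=O(n^{-1/2})$, and that $$\bigl(a_n+b_n-2\sqrt{a_nb_n}-1\bigr)\log n\to\infty\qquad(n\to\infty).$$ Then $$\Pi\bigl(\{\theta_{0,n}\}\bigm|X^n\bigr)\to 1\quad\text{in } P_{\theta_{0,n},n}\text{-probability, as } n\to\infty,$$ i.e. the posterior recovers the community assignment exactly.
   Context: Planted bi-section model. For $n\ge1$, $\Theta_n'$ is the set of $\theta'\in\{0,1\}^{2n}$ with exactly $n$ zeros and $n$ ones. Let $\neg\theta'$ denote component-wise negation, let $\sim_n$ be the equivalence relation identifying $\theta'$ with $\neg\theta'$, and let $\Theta_n=\Theta_n'/\sim_n$. Given $p_n,q_n\in(0,1)$ and $\theta\in\Theta_n$ with representative $\theta'$, $P_{\theta,n}$ is the law of the random simple undirected graph $X^n$ (no loops) on vertices $\{1,\dots,2n\}$, with adjacency indicators $X_{ij}$ ($i<j$), whose edges occur independently with $P_{\theta,n}(X_{ij}=1)=p_n$ if $\theta'_i=\theta'_j$ and $=q_n$ if $\theta'_i\ne\theta'_j$ (independent of the representative). Let $p_{\theta,n}(x^n)=P_{\theta,n}(X^n=x^n)$ be the likelihood. With the uniform prior on $\Theta_n$, the posterior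 is, for $A\subset\Theta_n$, $$\Pi(A|X^n)=\sum_{\theta\in A}p_{\theta,n}(X^n)\Big/\sum_{\theta\in\Theta_n}p_{\theta,n}(X^n).$$ The sequences $(p_n),(q_n)$ are known. *)

theory Defs
  imports "HOL-Probability.Probability" "HOL-Probability.Product_PMF"
begin

text \<open>Labellings of the vertex set \<open>{1..2n}\<close> with values in \<open>{0,1}\<close>; they are extensional
  functions, so that equality of labellings is equality of their values on \<open>{1..2n}\<close>.\<close>

definition labellings :: "nat \<Rightarrow> (nat \<Rightarrow> nat) set" where
  "labellings n = {t \<in> {1..2*n} \<rightarrow>\<^sub>E {0, 1}.
     card {i \<in> {1..2*n}. t i = 0} = n \<and> card {i \<in> {1..2*n}. t i = 1} = n}"

definition neg_labelling :: "nat \<Rightarrow> (nat \<Rightarrow> nat) \<Rightarrow> (nat \<Rightarrow> nat)" where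
  "neg_labelling n t = (\<lambda>i\<in>{1..2*n}. 1 - t i)"

definition label_rel :: "nat \<Rightarrow> ((nat \<Rightarrow> nat) \<times> (nat \<Rightarrow> nat)) set" where
  "label_rel n = {(s, t). s \<in> labellings n \<and> t \<in> labellings n \<and> (t = s \<or> t = neg_labelling n s)}"

definition bisections :: "nat \<Rightarrow> (nat \<Rightarrow> nat) set set" where
  "bisections n = labellings n // label_rel n"

definition vertex_pairs :: "nat \<Rightarrow> (nat \<times> nat) set" where
  "vertex_pairs n = {(i, j). 1 \<le> i \<and> i < j \<and> j \<le> 2*n}"

text \<open>A simple undirected graph on \<open>{1..2n}\<close> is represented by its adjacency indicators
  \<open>x (i, j)\<close>, \<open>i < j\<close>, set to \<open>False\<close> outside \<open>vertex_pairs n\<close>.\<close>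

definition labelled_graph_pmf ::
    "real \<Rightarrow> real \<Rightarrow> nat \<Rightarrow> (nat \<Rightarrow> nat) \<Rightarrow> (nat \<times> nat \<Rightarrow> bool) pmf" where
  "labelled_graph_pmf p q n t =
     Pi_pmf (vertex_pairs n) False (\<lambda>(i, j). bernoulli_pmf (if t i = t j then p else q))"

text \<open>The choice of the representative is immaterial, see \<open>bisection_graph_pmf_representative\<close>.\<close>

definition bisection_graph_pmf ::
    "real \<Rightarrow> real \<Rightarrow> nat \<Rightarrow> (nat \<Rightarrow> nat) set \<Rightarrow> (nat \<times> nat \<Rightarrow> bool) pmf" where
  "bisection_graph_pmf p q n \<theta> = labelled_graph_pmf p q n (SOME t. t \<in> \<theta>)"

text \<open>Posterior for the uniform prior on \<open>bisections n\<close>; the constant prior weights cancel.\<close>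

definition posterior ::
    "real \<Rightarrow> real \<Rightarrow> nat \<Rightarrow> (nat \<Rightarrow> nat) set set \<Rightarrow> (nat \<times> nat \<Rightarrow> bool) \<Rightarrow> real" where
  "posterior p q n A x =
     (\<Sum>\<theta>\<in>A. pmf (bisection_graph_pmf p q n \<theta>) x) /
     (\<Sum>\<theta>\<in>bisections n. pmf (bisection_graph_pmf p q n \<theta>) x)"

lemma neg_labelling_in_labellings:
  assumes "t \<in> labellings n"
  shows "neg_labelling n t \<in> labellings n"
proof -
  have t: "t i = 0 \<or> t i = 1" if "i \<in> {1..2*n}" for i
    using assms that by (auto simp: labellings_def PiE_iff)
  have z: "{i \<in> {1..2*n}. neg_labelling n t i = 0} = {i \<in> {1..2*n}. t i = 1}"
   and o: "{i \<in> {1..2*n}. neg_labelling n t i = 1} = {i \<in> {1..2*n}. t i = 0}"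
    using t by (force simp: neg_labelling_def)+
  have "neg_labelling n t \<in> {1..2*n} \<rightarrow>\<^sub>E {0, 1}"
    using t by (force simp: neg_labelling_def PiE_iff)
  with assms show ?thesis
    unfolding labellings_def mem_Collect_eq z o by blast
qed

lemma neg_neg_labelling:
  assumes "t \<in> labellings n"
  shows "neg_labelling n (neg_labelling n t) = t"
proof
  fix i
  show "neg_labelling n (neg_labelling n t) i = t i"
  proof (cases "i \<in> {1..2*n}")
    case True
    then have "t i \<in> {0, 1}" using assms by (auto simp: labellings_def PiE_iff)
    with True show ?thesis by (auto simp: neg_labelling_def)
  next
    case False
    then have "t i = undefined"
      using assms by (auto simp: labellings_def PiE_iff extensional_def)
    with False show ?thesis unfolding neg_labelling_def by (simp only: restrict_apply if_False)
  qed
qed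

lemma equiv_label_rel: "equiv (labellings n) (label_rel n)"
proof (rule equivI)
  show "label_rel n \<subseteq> labellings n \<times> labellings n" by (auto simp: label_rel_def)
  show "refl_on (labellings n) (label_rel n)" by (auto simp: refl_on_def label_rel_def)
  show "sym (label_rel n)" by (auto simp: sym_def label_rel_def neg_neg_labelling)
  show "trans (label_rel n)" by (auto simp: trans_def label_rel_def neg_neg_labelling)
qed

lemma labelled_graph_pmf_neg:
  assumes "t \<in> labellings n"
  shows "labelled_graph_pmf p q n (neg_labelling n t) = labelled_graph_pmf p q n t"
proof -
  have t: "t i = 0 \<or> t i = 1" if "i \<in> {1..2*n}" for i
    using assms that by (auto simp: labellings_def PiE_iff)
  have "neg_labelling n t i = neg_labelling n t j \<longleftrightarrow> t i = t j"
    if "(i, j) \<in> vertex_pairs n" for i j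
    using that t[of i] t[of j] by (auto simp: vertex_pairs_def neg_labelling_def)
  then show ?thesis
    unfolding labelled_graph_pmf_def by (intro Pi_pmf_cong) auto
qed

lemma bisection_graph_pmf_representative:
  assumes "\<theta> \<in> bisections n" "t \<in> \<theta>"
  shows "bisection_graph_pmf p q n \<theta> = labelled_graph_pmf p q n t"
proof -
  define s where "s = (SOME t. t \<in> \<theta>)"
  have "s \<in> \<theta>" unfolding s_def by (rule someI[of "\<lambda>t. t \<in> \<theta>", OF assms(2)])
  then have "(t, s) \<in> label_rel n"
    using assms quotient_eq_iff[OF equiv_label_rel, of \<theta> n \<theta> t s]
    by (auto simp: bisections_def)
  then show ?thesis
    unfolding bisection_graph_pmf_def s_def[symmetric]
    by (auto simp: label_rel_def labelled_graph_pmf_neg)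
qed

end

theory Submission
  imports Defs
begin

text \<open>
  The posterior probability that a wrong bisection \<open>\<theta>\<close> receives is at most
  \<open>p\<^sub>\<theta> / (p\<^sub>\<theta>\<^sub>0 + p\<^sub>\<theta>) \<le> sqrt (p\<^sub>\<theta> / p\<^sub>\<theta>\<^sub>0)\<close>, and the expectation of that square root under
  the true law is the Hellinger affinity of the two laws. By Markov's inequality it is therefore
  enough that the affinities of the truth with all wrong bisections have a vanishing sum
  (lemma \<open>prob_posterior_mass_deviates_le\<close>).

  Edges are independent, so affinities multiply over the vertex pairs. If \<open>\<theta>\<close> arises from the truth
  by exchanging \<open>k\<close> vertices of one side with \<open>k\<close> of the other, the edge probability changes on
  exactly the \<open>4 k (n - k)\<close> pairs with one moved and one unmoved end, and the affinity is
  \<open>\<rho> ^ (4 k (n - k))\<close> with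
  \<open>\<rho> = sqrt (p q) + sqrt ((1 - p) (1 - q)) \<le> exp (- (sqrt p - sqrt q)\<^sup>2 / 2)\<close>. As \<open>k\<close> and
  \<open>n - k\<close> describe the same bisection, it suffices to take \<open>1 \<le> k \<le> n / 2\<close>, and at most
  \<open>(n choose k)\<^sup>2\<close> bisections belong to each \<open>k\<close> (lemma \<open>sum_affinity_bisections_le\<close>).

  In the parametrisation of the theorem \<open>(sqrt p - sqrt q)\<^sup>2 = (ln n + M) / n\<close>, where \<open>M\<close> is the
  quantity assumed to diverge. The factor \<open>exp (- 2 k (n - k) ln n / n)\<close> then compensates the
  count \<open>(n choose k)\<^sup>2\<close> up to \<open>exp (4 k)\<close>, uniformly in \<open>k\<close>, while \<open>M\<close> contributes at most
  \<open>exp (- k M)\<close> because \<open>2 (n - k) \<ge> n\<close> (lemma \<open>exchange_term_le\<close>). Hence the sum of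
  affinities is dominated by the geometric series of \<open>exp (4 - M)\<close>, which tends to \<open>0\<close>.
\<close>

section \<open>Posterior mass and Hellinger affinity\<close>

text \<open>The integral of \<open>sqrt (P Q)\<close>, written as an expectation under \<open>P\<close>.\<close>

definition affinity :: "'a pmf \<Rightarrow> 'a pmf \<Rightarrow> real" where
  "affinity P Q = measure_pmf.expectation P (\<lambda>x. sqrt (pmf Q x / pmf P x))"

lemma fraction_le_sqrt_ratio:
  fixes u v :: real
  assumes "u > 0" "v \<ge> 0"
  shows "v / (u + v) \<le> sqrt (v / u)"
proof -
  define s t where "s = sqrt u" and "t = sqrt v"
  have st: "u = s^2" "v = t^2" "s > 0" "t \<ge> 0"
    using assms by (auto simp: s_def t_def)
  have "2 * s * t \<le> s^2 + t^2" by (rule sum_squares_bound)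
  moreover have "0 \<le> t * s" using st by simp
  ultimately have "t * s \<le> s^2 + t^2" by (simp only: mult_ac)
  then have "t * (t * s) \<le> t * (s^2 + t^2)"
    using st by (intro mult_left_mono) auto
  then have "t^2 / (s^2 + t^2) \<le> t / s"
    using st by (simp add: divide_simps add_pos_nonneg power2_eq_square algebra_simps)
  then show ?thesis
    using st by (simp add: real_sqrt_divide)
qed

text \<open>The missing posterior mass is the sum of the masses of the wrong parameters; each of them is
  estimated by comparing its likelihood with the true one alone, and Markov's inequality does the
  rest. The square roots are essential: for laws of full support the likelihood ratio itself has
  expectation one, however well the two laws are separated.\<close>

lemma prob_posterior_mass_deviates_le:
  fixes P :: "'t \<Rightarrow> 'a pmf"
  assumes "finite \<Theta>" "\<theta>\<^sub>0 \<in> \<Theta>" and fin: "finite (set_pmf (P \<theta>\<^sub>0))" and "\<epsilon> > 0"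
  shows "measure_pmf.prob (P \<theta>\<^sub>0) {x. \<bar>pmf (P \<theta>\<^sub>0) x / (\<Sum>\<theta>\<in>\<Theta>. pmf (P \<theta>) x) - 1\<bar> > \<epsilon>}
         \<le> (\<Sum>\<theta>\<in>\<Theta> - {\<theta>\<^sub>0}. affinity (P \<theta>\<^sub>0) (P \<theta>)) / \<epsilon>"
proof -
  define u where "u = (\<lambda>x. \<Sum>\<theta>\<in>\<Theta> - {\<theta>\<^sub>0}. sqrt (pmf (P \<theta>) x / pmf (P \<theta>\<^sub>0) x))"
  have int: "integrable (measure_pmf (P \<theta>\<^sub>0)) f" for f :: "'a \<Rightarrow> real"
    by (rule integrable_measure_pmf_finite[OF fin])
  have pointwise: "\<bar>pmf (P \<theta>\<^sub>0) x / (\<Sum>\<theta>\<in>\<Theta>. pmf (P \<theta>) x) - 1\<bar> \<le> u x"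
    if x: "x \<in> set_pmf (P \<theta>\<^sub>0)" for x
  proof -
    define Z where "Z = (\<Sum>\<theta>\<in>\<Theta>. pmf (P \<theta>) x)"
    have Z: "Z = pmf (P \<theta>\<^sub>0) x + (\<Sum>\<theta>\<in>\<Theta> - {\<theta>\<^sub>0}. pmf (P \<theta>) x)"
      unfolding Z_def using assms by (simp add: sum.remove)
    have pos: "pmf (P \<theta>\<^sub>0) x > 0" using x by (simp add: pmf_positive)
    have nonneg: "(\<Sum>\<theta>\<in>\<Theta> - {\<theta>\<^sub>0}. pmf (P \<theta>) x) \<ge> 0" by (intro sum_nonneg) auto
    have Zpos: "Z > 0" using Z pos nonneg by simp
    have "pmf (P \<theta>\<^sub>0) x / Z - 1 = - ((\<Sum>\<theta>\<in>\<Theta> - {\<theta>\<^sub>0}. pmf (P \<theta>) x) / Z)"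
      using Z Zpos by (simp add: field_simps)
    then have "\<bar>pmf (P \<theta>\<^sub>0) x / Z - 1\<bar> = (\<Sum>\<theta>\<in>\<Theta> - {\<theta>\<^sub>0}. pmf (P \<theta>) x) / Z"
      using nonneg Zpos by simp
    also have "\<dots> = (\<Sum>\<theta>\<in>\<Theta> - {\<theta>\<^sub>0}. pmf (P \<theta>) x / Z)" by (rule sum_divide_distrib)
    also have "\<dots> \<le> u x"
      unfolding u_def
    proof (rule sum_mono)
      fix \<theta> assume \<theta>: "\<theta> \<in> \<Theta> - {\<theta>\<^sub>0}"
      have "pmf (P \<theta>) x \<le> (\<Sum>\<theta>\<in>\<Theta> - {\<theta>\<^sub>0}. pmf (P \<theta>) x)"
        using \<theta> assms by (intro member_le_sum) auto
      then have "pmf (P \<theta>) x / Z \<le> pmf (P \<theta>) x / (pmf (P \<theta>\<^sub>0) x + pmf (P \<theta>) x)"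
        using Z pos Zpos by (intro divide_left_mono mult_pos_pos add_pos_nonneg) simp_all
      also have "\<dots> \<le> sqrt (pmf (P \<theta>) x / pmf (P \<theta>\<^sub>0) x)"
        by (rule fraction_le_sqrt_ratio) (use pos in auto)
      finally show "pmf (P \<theta>) x / Z \<le> sqrt (pmf (P \<theta>) x / pmf (P \<theta>\<^sub>0) x)" .
    qed
    finally show ?thesis unfolding Z_def .
  qed
  have "measure_pmf.prob (P \<theta>\<^sub>0) {x. \<bar>pmf (P \<theta>\<^sub>0) x / (\<Sum>\<theta>\<in>\<Theta>. pmf (P \<theta>) x) - 1\<bar> > \<epsilon>}
        \<le> measure_pmf.prob (P \<theta>\<^sub>0) {x \<in> space (measure_pmf (P \<theta>\<^sub>0)). u x \<ge> \<epsilon>}"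
    by (rule measure_pmf.finite_measure_mono_AE)
       (auto simp: AE_measure_pmf_iff dest!: pointwise)
  also have "\<dots> \<le> measure_pmf.expectation (P \<theta>\<^sub>0) u / \<epsilon>"
    by (rule integral_Markov_inequality_measure[where A = "{}"])
       (use assms int in \<open>auto simp: u_def intro!: sum_nonneg\<close>)
  also have "measure_pmf.expectation (P \<theta>\<^sub>0) u = (\<Sum>\<theta>\<in>\<Theta> - {\<theta>\<^sub>0}. affinity (P \<theta>\<^sub>0) (P \<theta>))"
    unfolding u_def affinity_def by (rule Bochner_Integration.integral_sum) (rule int)
  finally show ?thesis .
qed

lemma sqrt_prod: "sqrt (\<Prod>i\<in>A. f i) = (\<Prod>i\<in>A. sqrt (f i))"
  by (induction A rule: infinite_finite_induct) (auto simp: real_sqrt_mult)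

lemma affinity_Pi_pmf:
  fixes P Q :: "'i \<Rightarrow> 'a pmf"
  assumes "finite A" and "\<And>i. i \<in> A \<Longrightarrow> finite (set_pmf (P i))"
  shows "affinity (Pi_pmf A d P) (Pi_pmf A d Q) = (\<Prod>i\<in>A. affinity (P i) (Q i))"
proof -
  have "affinity (Pi_pmf A d P) (Pi_pmf A d Q) =
        measure_pmf.expectation (Pi_pmf A d P) (\<lambda>x. \<Prod>i\<in>A. sqrt (pmf (Q i) (x i) / pmf (P i) (x i)))"
    unfolding affinity_def
  proof (rule integral_cong_AE)
    show "AE x in measure_pmf (Pi_pmf A d P).
            sqrt (pmf (Pi_pmf A d Q) x / pmf (Pi_pmf A d P) x) =
            (\<Prod>i\<in>A. sqrt (pmf (Q i) (x i) / pmf (P i) (x i)))"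
    proof (rule AE_pmfI)
      fix x assume "x \<in> set_pmf (Pi_pmf A d P)"
      then have "x i = d" if "i \<notin> A" for i
        using set_Pi_pmf_subset[OF assms(1), of d P] that by blast
      then show "sqrt (pmf (Pi_pmf A d Q) x / pmf (Pi_pmf A d P) x) =
            (\<Prod>i\<in>A. sqrt (pmf (Q i) (x i) / pmf (P i) (x i)))"
        using assms(1) by (simp add: pmf_Pi' prod_dividef[symmetric] sqrt_prod)
    qed
  qed auto
  also have "\<dots> = (\<Prod>i\<in>A. affinity (P i) (Q i))"
    unfolding affinity_def
    by (rule expectation_prod_Pi_pmf) (use assms in \<open>auto intro: integrable_measure_pmf_finite\<close>)
  finally show ?thesis .
qed

definition bernoulli_affinity :: "real \<Rightarrow> real \<Rightarrow> real" where
  "bernoulli_affinity p q = sqrt (p * q) + sqrt ((1 - p) * (1 - q))"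

lemma bernoulli_affinity_commute: "bernoulli_affinity p q = bernoulli_affinity q p"
  by (simp add: bernoulli_affinity_def mult.commute)

lemma sqrt_ratio_times:
  fixes u v :: real
  assumes "u > 0"
  shows "sqrt (v / u) * u = sqrt (u * v)"
  using assms real_div_sqrt[of u]
  by (simp add: real_sqrt_divide real_sqrt_mult field_simps)

lemma affinity_bernoulli_pmf:
  assumes "0 < p" "p < 1" "0 < q" "q < 1"
  shows "affinity (bernoulli_pmf p) (bernoulli_pmf q) = bernoulli_affinity p q"
  using assms by (simp add: affinity_def bernoulli_affinity_def sqrt_ratio_times)

lemma affinity_self:
  "affinity P P = 1"
proof -
  have "affinity P P = measure_pmf.expectation P (\<lambda>x. 1)"
    unfolding affinity_def
    by (rule integral_cong_AE) (auto simp: AE_measure_pmf_iff set_pmf_iff)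
  then show ?thesis by simp
qed

lemma bernoulli_affinity_le_exp:
  assumes "0 < p" "p < 1" "0 < q" "q < 1"
  shows "bernoulli_affinity p q \<le> exp (- ((sqrt p - sqrt q)\<^sup>2 / 2))"
proof -
  have "sqrt (p * q) = (p + q) / 2 - (sqrt p - sqrt q)\<^sup>2 / 2"
    using assms by (simp add: power2_diff real_sqrt_mult field_simps)
  moreover have "sqrt ((1 - p) * (1 - q)) \<le> ((1 - p) + (1 - q)) / 2"
    using assms by (intro arith_geo_mean_sqrt) auto
  ultimately have "bernoulli_affinity p q \<le> 1 + - ((sqrt p - sqrt q)\<^sup>2 / 2)"
    by (simp add: bernoulli_affinity_def field_simps)
  also have "\<dots> \<le> exp (- ((sqrt p - sqrt q)\<^sup>2 / 2))" by (rule exp_ge_add_one_self)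
  finally show ?thesis .
qed

lemma bernoulli_affinity_nonneg:
  assumes "0 < p" "p < 1" "0 < q" "q < 1"
  shows "bernoulli_affinity p q \<ge> 0"
  using assms by (simp add: bernoulli_affinity_def)

section \<open>Affinity of two labellings\<close>

lemma finite_vertex_pairs: "finite (vertex_pairs n)"
  by (rule finite_subset[of _ "{1..2*n} \<times> {1..2*n}"]) (auto simp: vertex_pairs_def)

lemma labelling_cases:
  assumes "t \<in> labellings n" "i \<in> {1..2*n}"
  shows "t i = 0 \<or> t i = 1"
  using assms by (auto simp: labellings_def PiE_iff)

lemma card_cut_pairs:
  assumes "U \<subseteq> {1..2*n}"
  shows "card {e \<in> vertex_pairs n. (fst e \<in> U) \<noteq> (snd e \<in> U)} = card U * (2 * n - card U)"
proof -
  have fU: "finite U" using assms by (rule finite_subset) auto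
  have "bij_betw (\<lambda>(u, v). (min u v, max u v)) (U \<times> ({1..2*n} - U))
          {e \<in> vertex_pairs n. (fst e \<in> U) \<noteq> (snd e \<in> U)}"
    by (rule bij_betw_byWitness[where f' = "\<lambda>(i, j). if i \<in> U then (i, j) else (j, i)"])
       (use assms in \<open>auto simp: vertex_pairs_def min_def max_def subset_iff le_less split: if_splits\<close>)
  then have "card {e \<in> vertex_pairs n. (fst e \<in> U) \<noteq> (snd e \<in> U)} = card (U \<times> ({1..2*n} - U))"
    by (simp add: bij_betw_same_card)
  also have "\<dots> = card U * (2 * n - card U)"
    using assms fU by (simp add: card_cartesian_product card_Diff_subset)
  finally show ?thesis .
qed

text \<open>Moving a vertex to the other side alters the edge probability of a pair exactly when the
  other end of the pair stays; a pair with both ends moved is unaffected.\<close>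

lemma affinity_labelled_graph_pmf:
  assumes s: "s \<in> labellings n" and t: "t \<in> labellings n"
    and pq: "0 < p" "p < 1" "0 < q" "q < 1"
    and m: "m = card {i \<in> {1..2*n}. s i \<noteq> t i}"
  shows "affinity (labelled_graph_pmf p q n s) (labelled_graph_pmf p q n t) =
         bernoulli_affinity p q ^ (m * (2 * n - m))"
proof -
  define U where "U = {i \<in> {1..2*n}. s i \<noteq> t i}"
  define cut where "cut = (\<lambda>e. (fst e \<in> U) \<noteq> (snd e \<in> U))"
  have "affinity (labelled_graph_pmf p q n s) (labelled_graph_pmf p q n t) =
        (\<Prod>e\<in>vertex_pairs n. affinity ((\<lambda>(i, j). bernoulli_pmf (if s i = s j then p else q)) e)
                                   ((\<lambda>(i, j). bernoulli_pmf (if t i = t j then p else q)) e))"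
    unfolding labelled_graph_pmf_def
    by (rule affinity_Pi_pmf) (auto simp: finite_vertex_pairs)
  also have "\<dots> = (\<Prod>e\<in>vertex_pairs n. if cut e then bernoulli_affinity p q else 1)"
  proof (rule prod.cong, rule refl)
    fix e assume e: "e \<in> vertex_pairs n"
    obtain i j where ij: "e = (i, j)" by fastforce
    have V: "i \<in> {1..2*n}" "j \<in> {1..2*n}" using e by (auto simp: ij vertex_pairs_def)
    have "cut e \<longleftrightarrow> (s i = s j) \<noteq> (t i = t j)"
      using V labelling_cases[OF s V(1)] labelling_cases[OF s V(2)]
        labelling_cases[OF t V(1)] labelling_cases[OF t V(2)]
      by (auto simp: cut_def U_def ij)
    then show "affinity ((\<lambda>(i, j). bernoulli_pmf (if s i = s j then p else q)) e)
                 ((\<lambda>(i, j). bernoulli_pmf (if t i = t j then p else q)) e) =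
               (if cut e then bernoulli_affinity p q else 1)"
      using pq
      by (auto simp: ij affinity_self affinity_bernoulli_pmf[of p q] affinity_bernoulli_pmf[of q p]
          bernoulli_affinity_commute[of q p])
  qed
  also have "\<dots> = bernoulli_affinity p q ^ card {e \<in> vertex_pairs n. cut e}"
    by (simp add: prod.inter_filter[symmetric] finite_vertex_pairs)
  also have "card {e \<in> vertex_pairs n. cut e} = m * (2 * n - m)"
    unfolding cut_def m U_def[symmetric] by (rule card_cut_pairs) (auto simp: U_def)
  finally show ?thesis .
qed

section \<open>Counting bisections by the number of exchanged vertices\<close>

definition moved_up :: "nat \<Rightarrow> (nat \<Rightarrow> nat) \<Rightarrow> (nat \<Rightarrow> nat) \<Rightarrow> nat set" where
  "moved_up n s t = {i \<in> {1..2*n}. s i = 0 \<and> t i = 1}"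

definition moved_down :: "nat \<Rightarrow> (nat \<Rightarrow> nat) \<Rightarrow> (nat \<Rightarrow> nat) \<Rightarrow> nat set" where
  "moved_down n s t = {i \<in> {1..2*n}. s i = 1 \<and> t i = 0}"

text \<open>Both labellings are balanced, so as many vertices change in one direction as in the other.\<close>

lemma card_moved_down:
  assumes s: "s \<in> labellings n" and t: "t \<in> labellings n"
  shows "card (moved_down n s t) = card (moved_up n s t)"
proof -
  let ?C = "{i \<in> {1..2*n}. s i = 1 \<and> t i = 1}"
  have "{i \<in> {1..2*n}. t i = 1} = moved_up n s t \<union> ?C"
    using labelling_cases[OF s] by (auto simp: moved_up_def)
  then have "card {i \<in> {1..2*n}. t i = 1} = card (moved_up n s t) + card ?C"
    by (simp only:) (rule card_Un_disjoint, auto simp: moved_up_def)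
  moreover have "{i \<in> {1..2*n}. s i = 1} = moved_down n s t \<union> ?C"
    using labelling_cases[OF t] by (auto simp: moved_down_def)
  then have "card {i \<in> {1..2*n}. s i = 1} = card (moved_down n s t) + card ?C"
    by (simp only:) (rule card_Un_disjoint, auto simp: moved_down_def)
  ultimately show ?thesis using s t by (simp add: labellings_def)
qed

lemma card_disagreement:
  assumes s: "s \<in> labellings n" and t: "t \<in> labellings n"
  shows "card {i \<in> {1..2*n}. s i \<noteq> t i} = 2 * card (moved_up n s t)"
proof -
  have "{i \<in> {1..2*n}. s i \<noteq> t i} = moved_up n s t \<union> moved_down n s t"
  proof (rule set_eqI)
    fix i
    show "i \<in> {i \<in> {1..2*n}. s i \<noteq> t i} \<longleftrightarrow> i \<in> moved_up n s t \<union> moved_down n s t"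
      using labelling_cases[OF s, of i] labelling_cases[OF t, of i]
      by (auto simp: moved_up_def moved_down_def)
  qed
  then have "card {i \<in> {1..2*n}. s i \<noteq> t i} = card (moved_up n s t) + card (moved_down n s t)"
    by (simp only:) (rule card_Un_disjoint, auto simp: moved_up_def moved_down_def)
  then show ?thesis by (simp add: card_moved_down[OF s t])
qed

lemma labelling_eqI:
  assumes s: "s \<in> labellings n" and t: "t \<in> labellings n"
    and eq: "\<And>i. i \<in> {1..2*n} \<Longrightarrow> s i = t i"
  shows "s = t"
proof (rule PiE_ext)
  show "s \<in> {1..2*n} \<rightarrow>\<^sub>E {0, 1}" "t \<in> {1..2*n} \<rightarrow>\<^sub>E {0, 1}"
    using s t by (auto simp: labellings_def)
qed (use eq in auto)

lemma moved_up_empty_imp_eq: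
  assumes s: "s \<in> labellings n" and t: "t \<in> labellings n" and "card (moved_up n s t) = 0"
  shows "t = s"
proof -
  have "card {i \<in> {1..2*n}. s i \<noteq> t i} = 0"
    by (simp only: card_disagreement[OF s t] assms(3) mult_0_right)
  then have "{i \<in> {1..2*n}. s i \<noteq> t i} = {}" by (subst (asm) card_0_eq) auto
  then have "t i = s i" if "i \<in> {1..2*n}" for i
    using that by (metis (mono_tags, lifting) empty_iff mem_Collect_eq)
  then show ?thesis by (rule labelling_eqI[OF t s])
qed

lemma card_moved_up_neg:
  assumes s: "s \<in> labellings n" and t: "t \<in> labellings n"
  shows "card (moved_up n s (neg_labelling n t)) + card (moved_up n s t) = n"
proof -
  have "{i \<in> {1..2*n}. s i = 0} = moved_up n s (neg_labelling n t) \<union> moved_up n s t"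
    using labelling_cases[OF t] by (force simp: moved_up_def neg_labelling_def)
  then have "card {i \<in> {1..2*n}. s i = 0} =
      card (moved_up n s (neg_labelling n t)) + card (moved_up n s t)"
    by (simp only:) (rule card_Un_disjoint, auto simp: moved_up_def neg_labelling_def)
  then show ?thesis using s by (simp add: labellings_def)
qed

lemma finite_labellings: "finite (labellings n)"
  by (rule finite_subset[of _ "{1..2*n} \<rightarrow>\<^sub>E {0, 1}"])
     (auto simp: labellings_def intro: finite_PiE)

lemma card_labellings_moved_up_le:
  assumes s: "s \<in> labellings n"
  shows "card {t \<in> labellings n. card (moved_up n s t) = k} \<le> (n choose k)\<^sup>2"
proof -
  let ?X = "{t \<in> labellings n. card (moved_up n s t) = k}"
  let ?A = "{i \<in> {1..2*n}. s i = 0}" and ?B = "{i \<in> {1..2*n}. s i = 1}"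
  let ?Y = "{S. S \<subseteq> ?A \<and> card S = k} \<times> {T. T \<subseteq> ?B \<and> card T = k}"
  have "inj_on (\<lambda>t. (moved_up n s t, moved_down n s t)) ?X"
  proof (rule inj_onI)
    fix t u assume t: "t \<in> ?X" and u: "u \<in> ?X"
      and eq: "(moved_up n s t, moved_down n s t) = (moved_up n s u, moved_down n s u)"
    show "t = u"
    proof (rule labelling_eqI)
      fix i assume i: "i \<in> {1..2*n}"
      have "i \<in> moved_up n s t \<longleftrightarrow> i \<in> moved_up n s u"
        and "i \<in> moved_down n s t \<longleftrightarrow> i \<in> moved_down n s u"
        using eq by auto
      then show "t i = u i"
        using i t u labelling_cases[OF s i] labelling_cases[of t n i] labelling_cases[of u n i]
        by (auto simp: moved_up_def moved_down_def)
    qed (use t u in auto)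
  qed
  moreover have "(\<lambda>t. (moved_up n s t, moved_down n s t)) ` ?X \<subseteq> ?Y"
    using card_moved_down[OF s] by (auto simp: moved_up_def moved_down_def)
  moreover have "finite ?Y" by (intro finite_cartesian_product) auto
  ultimately have "card ?X \<le> card ?Y" by (rule card_inj_on_le)
  also have "card ?Y = (n choose k)\<^sup>2"
    using s n_subsets[of ?A k] n_subsets[of ?B k]
    by (simp add: card_cartesian_product labellings_def power2_eq_square)
  finally show ?thesis .
qed

lemma finite_bisections: "finite (bisections n)"
  unfolding bisections_def
  by (rule finite_quotient[OF finite_labellings]) (auto simp: label_rel_def)

text \<open>Negation turns \<open>k\<close> exchanged vertices into \<open>n - k\<close>, so one of the two representatives
  exchanges at most half of each side.\<close>

lemma ex_near_representative:
  assumes \<theta>\<^sub>0: "\<theta>\<^sub>0 \<in> bisections n" and s: "s \<in> \<theta>\<^sub>0"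
    and \<theta>: "\<theta> \<in> bisections n" and ne: "\<theta> \<noteq> \<theta>\<^sub>0"
  shows "\<exists>t\<in>\<theta>. t \<in> labellings n \<and> card (moved_up n s t) \<in> {1..n div 2}"
proof -
  have labs: "\<phi> \<subseteq> labellings n" if "\<phi> \<in> bisections n" for \<phi>
    using that in_quotient_imp_subset[of "labellings n" "label_rel n" \<phi>] equiv_label_rel[of n]
    by (auto simp: bisections_def)
  have sl: "s \<in> labellings n" using labs \<theta>\<^sub>0 s by auto
  obtain t where t: "t \<in> \<theta>" 
    using \<theta> in_quotient_imp_non_empty[OF equiv_label_rel, of \<theta> n] by (auto simp: bisections_def)
  have tl: "t \<in> labellings n" using labs \<theta> t by auto
  have nt: "neg_labelling n t \<in> \<theta>"
    using \<theta> t tl in_quotient_imp_closed[OF equiv_label_rel, of \<theta> n t "neg_labelling n t"]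
    by (auto simp: bisections_def label_rel_def neg_labelling_in_labellings)
  have disj: "\<theta> \<inter> \<theta>\<^sub>0 = {}"
    using quotient_disj[OF equiv_label_rel, of \<theta> n \<theta>\<^sub>0] \<theta> \<theta>\<^sub>0 ne by (auto simp: bisections_def)
  have pos: "card (moved_up n s u) \<ge> 1" if "u \<in> \<theta>" for u
    using moved_up_empty_imp_eq[OF sl, of u] labs[OF \<theta>] that disj s
    by (metis disjoint_iff less_one not_le subsetD)
  show ?thesis
  proof (cases "card (moved_up n s t) \<le> n div 2")
    case True
    then show ?thesis using t tl pos by auto
  next
    case False
    then have "card (moved_up n s (neg_labelling n t)) \<le> n div 2"
      using card_moved_up_neg[OF sl tl] by linarith
    then show ?thesis using nt neg_labelling_in_labellings[OF tl] pos by auto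
  qed
qed

lemma sum_affinity_bisections_le:
  assumes \<theta>\<^sub>0: "\<theta>\<^sub>0 \<in> bisections n" and pq: "0 < p" "p < 1" "0 < q" "q < 1"
  shows "(\<Sum>\<theta>\<in>bisections n - {\<theta>\<^sub>0}.
            affinity (bisection_graph_pmf p q n \<theta>\<^sub>0) (bisection_graph_pmf p q n \<theta>))
         \<le> (\<Sum>k\<in>{1..n div 2}. real ((n choose k)\<^sup>2) * bernoulli_affinity p q ^ (4 * k * (n - k)))"
proof -
  let ?\<rho> = "bernoulli_affinity p q"
  obtain s where s: "s \<in> \<theta>\<^sub>0"
    using \<theta>\<^sub>0 in_quotient_imp_non_empty[OF equiv_label_rel, of \<theta>\<^sub>0 n] by (auto simp: bisections_def)
  have sl: "s \<in> labellings n"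
    using \<theta>\<^sub>0 s in_quotient_imp_subset[of "labellings n" "label_rel n" \<theta>\<^sub>0] equiv_label_rel[of n]
    by (auto simp: bisections_def)
  define K where "K = (\<lambda>t. card (moved_up n s t))"
  define f where "f = (\<lambda>k. ?\<rho> ^ (4 * k * (n - k)))"
  define N where "N = {t \<in> labellings n. K t \<in> {1..n div 2}}"
  have f_nonneg: "f k \<ge> 0" for k
    using bernoulli_affinity_nonneg[OF pq] by (simp add: f_def)
  have finN: "finite N" using finite_labellings by (simp add: N_def)
  have "\<forall>\<theta>\<in>bisections n - {\<theta>\<^sub>0}. \<exists>t. t \<in> \<theta> \<and> t \<in> N"
    using ex_near_representative[OF \<theta>\<^sub>0 s] by (fastforce simp: N_def K_def)
  then obtain g where g: "\<And>\<theta>. \<theta> \<in> bisections n - {\<theta>\<^sub>0} \<Longrightarrow> g \<theta> \<in> \<theta> \<and> g \<theta> \<in> N"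
    by metis
  have inj: "inj_on g (bisections n - {\<theta>\<^sub>0})"
  proof (rule inj_onI)
    fix \<theta> \<phi> assume *: "\<theta> \<in> bisections n - {\<theta>\<^sub>0}" "\<phi> \<in> bisections n - {\<theta>\<^sub>0}" "g \<theta> = g \<phi>"
    then have "g \<theta> \<in> \<theta> \<inter> \<phi>" using g[of \<theta>] g[of \<phi>] by auto
    then show "\<theta> = \<phi>"
      using quotient_disj[OF equiv_label_rel, of \<theta> n \<phi>] * by (auto simp: bisections_def)
  qed
  have aff: "affinity (bisection_graph_pmf p q n \<theta>\<^sub>0) (bisection_graph_pmf p q n \<theta>) = f (K (g \<theta>))"
    if "\<theta> \<in> bisections n - {\<theta>\<^sub>0}" for \<theta>
  proof -
    have gl: "g \<theta> \<in> labellings n" using g[OF that] by (simp add: N_def)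
    have "bisection_graph_pmf p q n \<theta> = labelled_graph_pmf p q n (g \<theta>)"
      using that g[OF that] by (intro bisection_graph_pmf_representative) auto
    moreover have "bisection_graph_pmf p q n \<theta>\<^sub>0 = labelled_graph_pmf p q n s"
      using \<theta>\<^sub>0 s by (rule bisection_graph_pmf_representative)
    moreover have "affinity (labelled_graph_pmf p q n s) (labelled_graph_pmf p q n (g \<theta>)) =
        ?\<rho> ^ (2 * K (g \<theta>) * (2 * n - 2 * K (g \<theta>)))"
      by (rule affinity_labelled_graph_pmf[OF sl gl pq])
         (simp only: card_disagreement[OF sl gl] K_def)
    moreover have "2 * K (g \<theta>) * (2 * n - 2 * K (g \<theta>)) = 4 * K (g \<theta>) * (n - K (g \<theta>))"
      by (simp add: diff_mult_distrib2)
    ultimately show ?thesis by (simp add: f_def)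
  qed
  have "(\<Sum>\<theta>\<in>bisections n - {\<theta>\<^sub>0}.
            affinity (bisection_graph_pmf p q n \<theta>\<^sub>0) (bisection_graph_pmf p q n \<theta>))
        = (\<Sum>\<theta>\<in>bisections n - {\<theta>\<^sub>0}. f (K (g \<theta>)))"
    by (rule sum.cong) (use aff in auto)
  also have "\<dots> = (\<Sum>t\<in>g ` (bisections n - {\<theta>\<^sub>0}). f (K t))"
    by (simp add: sum.reindex[OF inj])
  also have "\<dots> \<le> (\<Sum>t\<in>N. f (K t))"
    by (rule sum_mono2[OF finN]) (use g f_nonneg in auto)
  also have "\<dots> = (\<Sum>k\<in>{1..n div 2}. \<Sum>t\<in>{t \<in> N. K t = k}. f (K t))"
    by (rule sum.group[symmetric]) (auto simp: finN, auto simp: N_def)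
  also have "\<dots> = (\<Sum>k\<in>{1..n div 2}. real (card {t \<in> N. K t = k}) * f k)"
    by (rule sum.cong) auto
  also have "\<dots> \<le> (\<Sum>k\<in>{1..n div 2}. real ((n choose k)\<^sup>2) * f k)"
  proof (intro sum_mono mult_right_mono f_nonneg)
    fix k
    have "card {t \<in> N. K t = k} \<le> card {t \<in> labellings n. card (moved_up n s t) = k}"
      using finite_labellings by (intro card_mono) (auto simp: N_def K_def)
    also have "\<dots> \<le> (n choose k)\<^sup>2" by (rule card_labellings_moved_up_le[OF sl])
    finally show "real (card {t \<in> N. K t = k}) \<le> real ((n choose k)\<^sup>2)"
      by (rule of_nat_mono)
  qed
  finally show ?thesis by (simp add: f_def)
qed

section \<open>The count against the affinity\<close>

text \<open>The \<open>k\<close>-th term of the exponential series of \<open>k\<close> is at most its sum.\<close>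

lemma power_self_le_fact_exp: "real k ^ k \<le> fact k * exp (real k)"
proof -
  have "(\<Sum>i\<in>{k}. real k ^ i /\<^sub>R fact i) \<le> exp (real k)"
    by (rule sums_le[OF _ sums_If_finite_set exp_converges]) auto
  then show ?thesis by (simp add: field_simps)
qed

lemma binomial_le_exp:
  assumes "1 \<le> k" "k \<le> n"
  shows "real (n choose k) \<le> exp (real k * (ln (real n) + 1 - ln (real k)))"
proof -
  have "real (n choose k) * fact k \<le> real n ^ k"
    using binomial_fact_pow[of n k] by (metis of_nat_fact of_nat_le_iff of_nat_mult of_nat_power)
  then have "real (n choose k) * (fact k * exp (real k)) \<le> real n ^ k * exp (real k)"
    unfolding mult.assoc[symmetric] by (rule mult_right_mono) simp
  moreover have "real (n choose k) * real k ^ k \<le> real (n choose k) * (fact k * exp (real k))"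
    by (rule mult_left_mono[OF power_self_le_fact_exp]) simp
  ultimately have "real (n choose k) * real k ^ k \<le> real n ^ k * exp (real k)"
    by (rule order_trans[rotated])
  then have "real (n choose k) \<le> real n ^ k * exp (real k) / real k ^ k"
    using assms by (simp add: field_simps)
  also have "\<dots> = exp (real k * (ln (real n) + 1 - ln (real k)))"
    using assms exp_of_nat_mult[of k "1 :: real"]
    by (simp add: exp_of_nat_mult exp_diff exp_add power_divide power_mult_distrib)
  finally show ?thesis .
qed

text \<open>This is \<open>n powr (k / n) \<le> e k\<close>, from \<open>ln (n / k) \<le> n / k\<close>. The exponent \<open>2 k (n - k) ln n / n\<close>
  falls short of the \<open>2 k ln n\<close> needed to cancel \<open>(n ^ k)\<^sup>2\<close> by \<open>2 k (k ln n / n)\<close>; this estimate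
  lets the factor \<open>(1 / fact k)\<^sup>2\<close> in the count make up for it, uniformly in \<open>k\<close>.\<close>

lemma ln_scaled_le:
  assumes "1 \<le> k" "k \<le> n"
  shows "real k / real n * ln (real n) \<le> ln (real k) + 1"
proof -
  have "ln (real n) = ln (real k) + ln (real n / real k)"
    using assms by (simp add: ln_div)
  moreover have "real k / real n * ln (real k) \<le> 1 * ln (real k)"
    using assms by (intro mult_right_mono) auto
  moreover have "real k / real n * ln (real n / real k) \<le> real k / real n * (real n / real k)"
    using assms ln_le_minus_one[of "real n / real k"] by (intro mult_left_mono) auto
  moreover have "real k / real n * (real n / real k) = 1"
    using assms by simp
  ultimately show ?thesis by (simp only: distrib_left)
qed

lemma exchange_term_le:
  assumes k: "1 \<le> k" "k \<le> n div 2" and "0 \<le> M"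
    and \<rho>: "0 \<le> \<rho>" "\<rho> \<le> exp (- ((ln (real n) + M) / real n / 2))"
  shows "real ((n choose k)\<^sup>2) * \<rho> ^ (4 * k * (n - k)) \<le> exp (4 - M) ^ k"
proof -
  define x y where "x = real n" and "y = real k"
  have k': "k \<le> n" "2 * k \<le> n" using k by auto
  have xy: "1 \<le> y" "2 * y \<le> x" "0 < x" using k k' by (auto simp: x_def y_def)
  have "(real (n choose k))\<^sup>2 \<le> (exp (y * (ln x + 1 - ln y)))\<^sup>2"
    unfolding x_def y_def by (rule power_mono[OF binomial_le_exp]) (use k k' in auto)
  also have "\<dots> = exp (2 * y * (ln x + 1 - ln y))"
    by (simp add: exp_double[symmetric] algebra_simps)
  finally have count: "(real (n choose k))\<^sup>2 \<le> exp (2 * y * (ln x + 1 - ln y))" .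
  have "\<rho> ^ (4 * k * (n - k)) \<le> exp (- ((ln x + M) / x / 2)) ^ (4 * k * (n - k))"
    unfolding x_def by (rule power_mono[OF \<rho>(2,1)])
  also have "\<dots> = exp (real (4 * k * (n - k)) * (- ((ln x + M) / x / 2)))"
    by (rule exp_of_nat_mult[symmetric])
  also have "real (4 * k * (n - k)) = 4 * y * (x - y)"
    using k' by (simp add: x_def y_def of_nat_diff)
  finally have power: "\<rho> ^ (4 * k * (n - k)) \<le> exp (4 * y * (x - y) * (- ((ln x + M) / x / 2)))" .
  have "real ((n choose k)\<^sup>2) * \<rho> ^ (4 * k * (n - k))
      \<le> exp (2 * y * (ln x + 1 - ln y)) * exp (4 * y * (x - y) * (- ((ln x + M) / x / 2)))"
    using count power \<rho> by (intro mult_mono) auto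
  also have "\<dots> = exp (2 * y * (1 + (y / x * ln x - ln y)) - M * (y * (2 * (x - y) / x)))"
    using xy by (simp add: exp_add[symmetric] field_simps)
  also have "\<dots> \<le> exp (4 * y - M * y)"
  proof -
    have "2 * y * (1 + (y / x * ln x - ln y)) \<le> 2 * y * (1 + 1)"
      using ln_scaled_le[of k n] k k' xy
      by (intro mult_left_mono add_left_mono) (auto simp: x_def y_def)
    moreover have "y * 1 \<le> y * (2 * (x - y) / x)"
      using xy by (intro mult_left_mono) (auto simp: field_simps)
    then have "M * y \<le> M * (y * (2 * (x - y) / x))"
      using \<open>0 \<le> M\<close> by (intro mult_left_mono) auto
    ultimately show ?thesis by simp
  qed
  also have "\<dots> = exp (4 - M) ^ k"
    by (simp add: exp_of_nat_mult[symmetric] y_def algebra_simps)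
  finally show ?thesis .
qed

section \<open>Exact recovery\<close>

lemma sum_powers_from_1_le:
  fixes r :: real
  assumes "0 \<le> r" "r < 1"
  shows "(\<Sum>k\<in>{1..m}. r ^ k) \<le> r / (1 - r)"
proof -
  have "(\<Sum>k\<in>{1..m}. r ^ k) = (r - r ^ Suc m) / (1 - r)"
    using assms sum_gp[of r 1 m] by (cases m) auto
  also have "\<dots> \<le> r / (1 - r)"
    using assms by (intro divide_right_mono) auto
  finally show ?thesis .
qed

text \<open>A non-asymptotic form of the theorem. The separation of the edge probabilities is measured by
  the excess \<open>M\<close> of \<open>n (sqrt p - sqrt q)\<^sup>2\<close> over \<open>ln n\<close>.\<close>

lemma prob_posterior_deviates_le:
  assumes \<theta>\<^sub>0: "\<theta>\<^sub>0 \<in> bisections n" and pq: "0 < p" "p < 1" "0 < q" "q < 1"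
    and sep: "(sqrt p - sqrt q)\<^sup>2 = (ln (real n) + M) / real n" and M: "M > 4" and "\<epsilon> > 0"
  shows "measure_pmf.prob (bisection_graph_pmf p q n \<theta>\<^sub>0) {x. \<bar>posterior p q n {\<theta>\<^sub>0} x - 1\<bar> > \<epsilon>}
         \<le> exp (4 - M) / (1 - exp (4 - M)) / \<epsilon>"
proof -
  have fin: "finite (set_pmf (bisection_graph_pmf p q n \<theta>\<^sub>0))"
    unfolding bisection_graph_pmf_def labelled_graph_pmf_def
    by (simp add: set_Pi_pmf finite_vertex_pairs) (rule finite_PiE_dflt, auto simp: finite_vertex_pairs)
  have "measure_pmf.prob (bisection_graph_pmf p q n \<theta>\<^sub>0) {x. \<bar>posterior p q n {\<theta>\<^sub>0} x - 1\<bar> > \<epsilon>}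
      \<le> (\<Sum>\<theta>\<in>bisections n - {\<theta>\<^sub>0}.
            affinity (bisection_graph_pmf p q n \<theta>\<^sub>0) (bisection_graph_pmf p q n \<theta>)) / \<epsilon>"
    using prob_posterior_mass_deviates_le
        [OF finite_bisections \<theta>\<^sub>0, of "bisection_graph_pmf p q n", OF fin \<open>\<epsilon> > 0\<close>]
    by (simp add: posterior_def)
  also have "\<dots> \<le> (\<Sum>k\<in>{1..n div 2}.
        real ((n choose k)\<^sup>2) * bernoulli_affinity p q ^ (4 * k * (n - k))) / \<epsilon>"
    using \<open>\<epsilon> > 0\<close> by (intro divide_right_mono sum_affinity_bisections_le \<theta>\<^sub>0 pq) auto
  also have "\<dots> \<le> (\<Sum>k\<in>{1..n div 2}. exp (4 - M) ^ k) / \<epsilon>"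
    using \<open>\<epsilon> > 0\<close> M bernoulli_affinity_nonneg[OF pq] bernoulli_affinity_le_exp[OF pq]
    by (intro divide_right_mono sum_mono exchange_term_le) (auto simp: sep)
  also have "\<dots> \<le> exp (4 - M) / (1 - exp (4 - M)) / \<epsilon>"
    using \<open>\<epsilon> > 0\<close> M by (intro divide_right_mono sum_powers_from_1_le) auto
  finally show ?thesis .
qed

theorem theorem3p1:
  fixes p q a b :: "nat \<Rightarrow> real" and \<theta>\<^sub>0 :: "nat \<Rightarrow> (nat \<Rightarrow> nat) set"
  assumes "\<And>n. n \<ge> 1 \<Longrightarrow> \<theta>\<^sub>0 n \<in> bisections n"
    and "\<And>n. n \<ge> 1 \<Longrightarrow> 0 < p n \<and> p n < 1"
    and "\<And>n. n \<ge> 1 \<Longrightarrow> 0 < q n \<and> q n < 1"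
    and "\<And>n. n \<ge> 2 \<Longrightarrow> p n = a n * ln (real n) / real n"
    and "\<And>n. n \<ge> 2 \<Longrightarrow> q n = b n * ln (real n) / real n"
    and "p \<in> O(\<lambda>n. real n powr (- 1 / 2))"
    and "q \<in> O(\<lambda>n. real n powr (- 1 / 2))"
    and "filterlim (\<lambda>n. (a n + b n - 2 * sqrt (a n * b n) - 1) * ln (real n)) at_top sequentially"
  shows "\<forall>\<epsilon>>0. (\<lambda>n. measure_pmf.prob (bisection_graph_pmf (p n) (q n) n (\<theta>\<^sub>0 n))
           {x. \<bar>posterior (p n) (q n) n {\<theta>\<^sub>0 n} x - 1\<bar> > \<epsilon>}) \<longlonglongrightarrow> 0"
proof (intro allI impI)
  fix \<epsilon> :: real assume \<epsilon>: "\<epsilon> > 0"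
  define M where "M = (\<lambda>n. (a n + b n - 2 * sqrt (a n * b n) - 1) * ln (real n))"
  have M_top: "filterlim M at_top sequentially" using assms(8) by (simp add: M_def)
  have sep: "(sqrt (p n) - sqrt (q n))\<^sup>2 = (ln (real n) + M n) / real n" if "n \<ge> 2" for n
  proof -
    define L where "L = ln (real n) / real n"
    have L: "L > 0" using that by (simp add: L_def)
    have p: "p n = a n * L" and q: "q n = b n * L"
      using assms(4,5)[OF that] by (simp_all add: L_def)
    have pos: "0 < p n" "0 < q n" using assms(2,3)[of n] that by auto
    have "sqrt (p n) * sqrt (q n) = sqrt (a n * b n * L\<^sup>2)"
      by (simp add: real_sqrt_mult[symmetric] p q power2_eq_square mult_ac)
    also have "\<dots> = sqrt (a n * b n) * L"
      using L by (simp add: real_sqrt_mult)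
    finally have "sqrt (p n) * sqrt (q n) = sqrt (a n * b n) * L" .
    then have "(sqrt (p n) - sqrt (q n))\<^sup>2 = (a n + b n - 2 * sqrt (a n * b n)) * L"
      using pos by (simp add: power2_diff p q algebra_simps)
    also have "\<dots> = (ln (real n) + M n) / real n"
      using that by (simp add: L_def M_def field_simps)
    finally show ?thesis .
  qed
  have bound: "\<forall>\<^sub>F n in sequentially.
      measure_pmf.prob (bisection_graph_pmf (p n) (q n) n (\<theta>\<^sub>0 n))
        {x. \<bar>posterior (p n) (q n) n {\<theta>\<^sub>0 n} x - 1\<bar> > \<epsilon>}
      \<le> exp (4 - M n) / (1 - exp (4 - M n)) / \<epsilon>"
    using filterlim_at_top_dense[THEN iffD1, OF M_top, rule_format, of 4] eventually_ge_at_top[of 2]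
  proof eventually_elim
    case (elim n)
    then show ?case
      using assms(1-3)[of n] sep[of n] \<epsilon> by (intro prob_posterior_deviates_le) auto
  qed
  have null: "(\<lambda>n. exp (4 - M n) / (1 - exp (4 - M n)) / \<epsilon>) \<longlonglongrightarrow> 0"
  proof -
    have "filterlim (\<lambda>n. 4 - M n) at_bot sequentially"
      using filterlim_uminus_at_top[THEN iffD1,
          OF filterlim_tendsto_add_at_top[OF tendsto_const[of "-4::real"] M_top]]
      by simp
    then have "(\<lambda>n. exp (4 - M n)) \<longlonglongrightarrow> 0"
      by (rule filterlim_compose[OF exp_at_bot])
    then have "(\<lambda>n. exp (4 - M n) / (1 - exp (4 - M n)) / \<epsilon>) \<longlonglongrightarrow> 0 / (1 - 0) / \<epsilon>"
      using \<epsilon> by (intro tendsto_intros) auto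
    then show ?thesis by simp
  qed
  show "(\<lambda>n. measure_pmf.prob (bisection_graph_pmf (p n) (q n) n (\<theta>\<^sub>0 n))
           {x. \<bar>posterior (p n) (q n) n {\<theta>\<^sub>0 n} x - 1\<bar> > \<epsilon>}) \<longlonglongrightarrow> 0"
    by (rule tendsto_sandwich[OF always_eventually bound tendsto_const null]) simp
qed

end
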